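(* Let $\mathcal G=\{(f,\eta):\|f\|^2+\|\eta\|^2\le1\}$, and assume that one of the following conditions is fulfilled: 1) $R(L)$ and $H(N(L))$ are closed sets; 2) $R(T)=\{[Lx,Hx]:x\in\mathscr D(L)\}$ is a closed set. Then the minimax a posteriori estimation $\hat\varphi$ (in the direction $\ell\in\mathcal H$) obeys the equations $$L^*\hat q=H^*(y-H\hat\varphi),\qquad L\hat\varphi=\hat q$$ if and only if $\ell\in R(L^* )+R(H^* )$. The estimation error is given by $$\hat d(\ell)=\bigl(1-(y,y-H\hat\varphi)\bigr)^{1/2}\,\hat\sigma(\ell).$$
   Context: $\mathcal H,\mathcal F,\mathcal Y$ are Hilbert spaces, with inner products denoted $(\cdot,\cdot)$. $L:\mathcal H\to\mathcal F$ is a closed linear operator whose domain $\mathscr D(L)$ is dense in $\mathcal H$; $H\in\mathscr L(\mathcal H,\mathcal Y)$ is a bounded linear operator. $L^*,H^*$ are the adjoints, $N(L)$ is the kernel of $L$, $R(\cdot)$ denotes the range. In the equations, $\hat\varphi\in\mathscr D(L)$ and $\hat q\in\mathscr D(L^* )$. The pairs $(f,\eta)$ in $\mathcal G$ range over $\mathcal F\times\mathcal Y$. A posteriori estimation (deterministic $\eta$): one observes $y=H\varphi+\eta$ with $(L\varphi,\eta)\in\mathcal G$. The a posteriori set is $\mathcal X_y=\{\varphi\in\mathscr D(L):(L\varphi,y-H\varphi)\in\mathcal G\}$, which is nonempty since $y$ is an observation of this form. A vector $\hat\varphi$ is called a minimax a posteriori estimation of $\varphi$ in the direction $\ell$ iff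 $$\hat d(\ell):=\inf_{\varphi\in\mathcal X_y}\sup_{\psi\in\mathcal X_y}|(\ell,\varphi)-(\ell,\psi)|=\sup_{\psi\in\mathcal X_y}|(\ell,\hat\varphi)-(\ell,\psi)|,$$ and $\hat d(\ell)$ is called the minimax a posteriori error in the direction $\ell$. The (a priori, mean-squared) minimax error $\hat\sigma(\ell)$ is defined by $$\hat\sigma(\ell)^2=\inf_{u\in\mathcal Y,\,c\in\mathbb R}\ \sup_{\varphi,\eta}M\bigl((\ell,\varphi)-(u,H\varphi+\eta)-c\bigr)^2,$$ where $M$ is mathematical expectation and the supremum is over all $\varphi\in\mathscr D(L)$ with $\|L\varphi\|\le1$ and all random zero-mean $\mathcal Y$-valued vectors $\eta$ with $M(\eta,\eta)\le1$. *)

theory Defs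
  imports "HOL-Probability.Probability"
begin

text \<open>
  An unbounded operator is a pair of a domain \<open>D\<close> and a function \<open>L\<close> whose values outside
  \<open>D\<close> are irrelevant. Hilbert spaces are real: types of sort \<open>{real_inner, complete_space}\<close>.
\<close>

definition closed_dense_operator ::
    "'h::real_inner set \<Rightarrow> ('h \<Rightarrow> 'f::real_inner) \<Rightarrow> bool" where
  "closed_dense_operator D L \<longleftrightarrow>
     subspace D \<and> closure D = UNIV \<and>
     (\<forall>x\<in>D. \<forall>x'\<in>D. L (x + x') = L x + L x') \<and>
     (\<forall>c. \<forall>x\<in>D. L (c *\<^sub>R x) = c *\<^sub>R L x) \<and>
     closed ((\<lambda>x. (x, L x)) ` D)"

definition adj_dom :: "'h::real_inner set \<Rightarrow> ('h \<Rightarrow> 'f::real_inner) \<Rightarrow> 'f set" where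
  "adj_dom D L = {q. \<exists>z. \<forall>x\<in>D. L x \<bullet> q = x \<bullet> z}"

text \<open>The value is unique when \<open>D\<close> is dense.\<close>

definition adj :: "'h::real_inner set \<Rightarrow> ('h \<Rightarrow> 'f::real_inner) \<Rightarrow> 'f \<Rightarrow> 'h" where
  "adj D L q = (THE z. \<forall>x\<in>D. L x \<bullet> q = x \<bullet> z)"

definition apost_set ::
    "'h::real_inner set \<Rightarrow> ('h \<Rightarrow> 'f::real_inner) \<Rightarrow> ('h \<Rightarrow> 'y::real_inner) \<Rightarrow> ('f \<times> 'y) set
     \<Rightarrow> 'y \<Rightarrow> 'h set" where
  "apost_set D L H G y = {\<phi>\<in>D. (L \<phi>, y - H \<phi>) \<in> G}"

definition worst_dev :: "'h::real_inner set \<Rightarrow> 'h \<Rightarrow> 'h \<Rightarrow> ereal" where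
  "worst_dev X l \<phi> = (SUP \<psi>\<in>X. ereal \<bar>l \<bullet> \<phi> - l \<bullet> \<psi>\<bar>)"

definition apost_error :: "'h::real_inner set \<Rightarrow> 'h \<Rightarrow> ereal" where
  "apost_error X l = (INF \<phi>\<in>X. worst_dev X l \<phi>)"

text \<open>
  The error is required to be a finite number. Otherwise, whenever it is infinite, every vector
  would be an estimation, since both sides of the equation would be infinite.
\<close>

definition minimax_apost_est :: "'h::real_inner set \<Rightarrow> 'h \<Rightarrow> 'h \<Rightarrow> bool" where
  "minimax_apost_est X l \<phi> \<longleftrightarrow>
     \<bar>apost_error X l\<bar> \<noteq> \<infinity> \<and> apost_error X l = worst_dev X l \<phi>"

text \<open>
  Random vectors \<open>\<eta>\<close> with zero mean and second moment at most 1. The mean \<open>m\<close> of a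
  square-integrable \<open>\<eta>\<close> in a Hilbert space is given by \<open>(m, v) = M (\<eta>, v)\<close> for all \<open>v\<close>;
  this needs no separability. Probability spaces are taken over the type \<open>'y\<close> because a
  supremum cannot range over all types; this loses nothing, as every random vector has the
  same law as the identity on \<open>'y\<close> equipped with that law.
\<close>

definition noises :: "('y::real_inner measure \<times> ('y \<Rightarrow> 'y)) set" where
  "noises = {(M, \<eta>). prob_space M \<and> \<eta> \<in> borel_measurable M \<and>
      (\<forall>v. (\<integral>w. \<eta> w \<bullet> v \<partial>M) = 0) \<and>
      integrable M (\<lambda>w. \<eta> w \<bullet> \<eta> w) \<and> (\<integral>w. \<eta> w \<bullet> \<eta> w \<partial>M) \<le> 1}"

definition mean_square_minimax ::
    "'h::real_inner set \<Rightarrow> ('h \<Rightarrow> 'f::real_inner) \<Rightarrow> ('h \<Rightarrow> 'y::real_inner) \<Rightarrow> 'h \<Rightarrow> ereal" where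
  "mean_square_minimax D L H l =
     (INF (u, c)\<in>(UNIV :: ('y \<times> real) set).
        SUP (\<phi>, (M, \<eta>))\<in>{\<phi>\<in>D. norm (L \<phi>) \<le> 1} \<times> noises.
          ereal (\<integral>w. (l \<bullet> \<phi> - u \<bullet> (H \<phi> + \<eta> w) - c)\<^sup>2 \<partial>M))"

definition apriori_error ::
    "'h::real_inner set \<Rightarrow> ('h \<Rightarrow> 'f::real_inner) \<Rightarrow> ('h \<Rightarrow> 'y::real_inner) \<Rightarrow> 'h \<Rightarrow> ereal" where
  "apriori_error D L H l =
     (if mean_square_minimax D L H l = \<infinity> then \<infinity>
      else ereal (sqrt (real_of_ereal (mean_square_minimax D L H l))))"

definition estimation_equations ::
    "'h::real_inner set \<Rightarrow> ('h \<Rightarrow> 'f::real_inner) \<Rightarrow> ('h \<Rightarrow> 'y::real_inner) \<Rightarrow> 'y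
     \<Rightarrow> 'h \<Rightarrow> 'f \<Rightarrow> bool" where
  "estimation_equations D L H y \<phi> q \<longleftrightarrow>
     \<phi> \<in> D \<and> q \<in> adj_dom D L \<and> adj D L q = adjoint H (y - H \<phi>) \<and> L \<phi> = q"

end

theory Submission
  imports Defs
begin

text \<open>
  Put \<open>T x = (L x, H x)\<close>. By the open mapping theorem the first range condition implies the
  second, so \<open>R(T)\<close> is closed and the equations are solved by the \<open>\<phi>\<close> for which \<open>T \<phi>\<close> is the
  projection of \<open>(0, y)\<close> onto \<open>R(T)\<close>. By Pythagoras the a posteriori set is
  \<open>\<phi> + {z. |T z|^2 \<le> 1 - (y, y - H \<phi>)}\<close>. It is symmetric about \<open>\<phi>\<close>, hence the estimations are
  exactly the vectors with the same \<open>l\<close>-component as \<open>\<phi>\<close>, provided \<open>l\<close> is bounded on the set.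
  Boundedness forces \<open>l\<close> to vanish on \<open>N(T)\<close>; by the closed range theorem this means
  \<open>(l, x) = (T p, T x)\<close> for some \<open>p\<close>, i.e. \<open>l \<in> R(L*) + R(H*)\<close>. Then the a posteriori error is
  \<open>(1 - (y, y - H \<phi>))^(1/2) |T p|\<close>, and \<open>|T p|\<close> is the a priori error: the choice \<open>u = H p\<close>,
  \<open>c = 0\<close> attains it, and a two-point noise \<open>\<plusminus>u/|u|\<close> together with suitable multiples of \<open>p\<close>
  shows that no other choice does better.
\<close>

subsection \<open>Riesz representation and projections\<close>

text \<open>If \<open>f\<close> is the inner product with \<open>p\<close>, then \<open>J x\<close>
  equals \<open>|x - p|^2 - |p|^2\<close>, so the representing vector is found by minimising
  \<open>J\<close> over \<open>S\<close>. Linearity and boundedness are asked only on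
  \<open>S\<close>, because later functionals make sense only on the range of an operator.\<close>

lemma riesz_on_closed_subspace:
  fixes S :: "'a::{real_inner, complete_space} set" and f :: "'a \<Rightarrow> real"
  assumes S: "subspace S" "closed S"
    and add: "\<And>x x'. x \<in> S \<Longrightarrow> x' \<in> S \<Longrightarrow> f (x + x') = f x + f x'"
    and scale: "\<And>c x. x \<in> S \<Longrightarrow> f (c *\<^sub>R x) = c * f x"
    and bound: "\<And>x. x \<in> S \<Longrightarrow> \<bar>f x\<bar> \<le> C * norm x"
  obtains p where "p \<in> S" "\<And>x. x \<in> S \<Longrightarrow> f x = p \<bullet> x"
proof -
  define J where "J x = x \<bullet> x - 2 * f x" for x
  have bd: "J x \<ge> - C\<^sup>2" if "x \<in> S" for x
  proof -
    have "0 \<le> (norm x - C)\<^sup>2" by simp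
    then have "(norm x)\<^sup>2 - 2 * (C * norm x) \<ge> - C\<^sup>2"
      by (simp add: power2_diff algebra_simps)
    with bound[OF that] show ?thesis unfolding J_def power2_norm_eq_inner by linarith
  qed
  define m where "m = Inf (J ` S)"
  have bb: "bdd_below (J ` S)" using bd by (auto simp: bdd_below_def)
  have ne: "S \<noteq> {}" using S(1) subspace_0 by blast
  have m_le: "m \<le> J x" if "x \<in> S" for x
    unfolding m_def by (rule cInf_lower) (use bb that in auto)
  have "\<exists>x\<in>S. J x < m + inverse (real (Suc n))" for n
  proof -
    have "Inf (J ` S) < m + inverse (real (Suc n))" by (simp add: m_def)
    then show ?thesis using cInf_lessD[of "J ` S"] ne by auto
  qed
  then obtain x where xS: "\<And>n. x n \<in> S" and xJ: "\<And>n. J (x n) < m + inverse (real (Suc n))"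
    by metis
  \<comment> \<open>Parallelogram law: the midpoint of \<open>a\<close> and \<open>b\<close> lies in
    \<open>S\<close>, so \<open>J\<close> is at least \<open>m\<close> there. This bounds
    \<open>|a - b|\<close> by the excess of \<open>J a\<close> and \<open>J b\<close> over
    \<open>m\<close>, which makes minimising sequences Cauchy.\<close>
  have par: "(norm (a - b))\<^sup>2 \<le> 2 * (J a + J b - 2 * m)" if "a \<in> S" "b \<in> S" for a b
  proof -
    have ab: "a + b \<in> S" using S(1) that by (simp add: subspace_add)
    then have "(1/2) *\<^sub>R (a + b) \<in> S" using S(1) subspace_scale by blast
    from m_le[OF this] have "m \<le> (1/4) * ((a + b) \<bullet> (a + b)) - (f a + f b)"
      unfolding J_def scale[OF ab] add[OF that] by (simp add: add_divide_distrib)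
    then have "4 * m \<le> (a + b) \<bullet> (a + b) - 4 * (f a + f b)" by simp
    moreover have "(norm (a - b))\<^sup>2 + (a + b) \<bullet> (a + b) = 2 * (a \<bullet> a + b \<bullet> b)"
      unfolding power2_norm_eq_inner
      by (simp add: inner_diff_left inner_diff_right inner_add_left inner_add_right)
    ultimately show ?thesis unfolding J_def by (simp add: algebra_simps)
  qed
  have "Cauchy x"
    unfolding Cauchy_iff
  proof (intro allI impI)
    fix e :: real assume e: "e > 0"
    \<comment> \<open>With two excesses below \<open>e\<^sup>2 / 4\<close> each, \<open>par\<close>
      gives twice their sum, hence less than \<open>e\<^sup>2\<close>.\<close>
    then obtain N where N: "inverse (real (Suc N)) < e\<^sup>2 / 4"
      using reals_Archimedean[of "e\<^sup>2 / 4"] by auto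
    show "\<exists>M. \<forall>i\<ge>M. \<forall>j\<ge>M. norm (x i - x j) < e"
    proof (intro exI allI impI)
      fix i j assume "N \<le> i" "N \<le> j"
      then have "inverse (real (Suc i)) \<le> inverse (real (Suc N))"
        "inverse (real (Suc j)) \<le> inverse (real (Suc N))"
        by (simp_all add: le_imp_inverse_le)
      then have "(norm (x i - x j))\<^sup>2 < e\<^sup>2"
        using par[OF xS xS, of i j] xJ[of i] xJ[of j] N by argo
      then show "norm (x i - x j) < e" using e power_less_imp_less_base by fastforce
    qed
  qed
  then obtain p where lim: "x \<longlonglongrightarrow> p" using Cauchy_convergent convergent_def by blast
  have pS: "p \<in> S" using S(2) xS lim closed_sequentially by blast
  have fdiff: "f (a - b) = f a - f b" if "a \<in> S" "b \<in> S" for a b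
    using add[of "a - b" b] that S(1) by (simp add: subspace_diff)
  have "(\<lambda>n. f (x n) - f p) \<longlonglongrightarrow> 0"
  proof (rule Lim_null_comparison)
    show "\<forall>\<^sub>F n in sequentially. norm (f (x n) - f p) \<le> C * norm (x n - p)"
      using bound[of "x _ - p"] fdiff[OF xS pS] S(1) xS pS by (simp add: subspace_diff)
    show "(\<lambda>n. C * norm (x n - p)) \<longlonglongrightarrow> 0"
      using lim by (intro tendsto_mult_right_zero tendsto_norm_zero) (simp add: LIM_zero)
  qed
  then have flim: "(\<lambda>n. f (x n)) \<longlonglongrightarrow> f p" by (simp add: LIM_zero_cancel)
  have "(\<lambda>n. J (x n)) \<longlonglongrightarrow> J p"
    unfolding J_def by (intro tendsto_intros lim flim)
  moreover have "(\<lambda>n. m + inverse (real (Suc n))) \<longlonglongrightarrow> m"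
    using tendsto_add[OF tendsto_const LIMSEQ_inverse_real_of_nat, of m] by simp
  ultimately have "J p \<le> m"
    by (rule LIMSEQ_le) (use xJ in \<open>auto intro!: exI[of _ 0] less_imp_le\<close>)
  have eq: "f v = p \<bullet> v" if v: "v \<in> S" for v
  proof (rule ccontr)
    assume "f v \<noteq> p \<bullet> v"
    define d where "d = p \<bullet> v - f v"
    have d: "d \<noteq> 0" using \<open>f v \<noteq> p \<bullet> v\<close> by (simp add: d_def)
    \<comment> \<open>First variation: the minimum of \<open>J\<close> at \<open>p\<close> makes
      this quadratic in \<open>t\<close> nonnegative, although its linear coefficient
      \<open>2 * d\<close> is nonzero.\<close>
    have q: "0 \<le> 2 * t * d + t\<^sup>2 * (v \<bullet> v)" for t
    proof -
      have tv: "t *\<^sub>R v \<in> S" using S(1) v subspace_scale by blast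
      have "p + t *\<^sub>R v \<in> S" using S(1) pS tv subspace_add by blast
      from m_le[OF this] \<open>J p \<le> m\<close> have "J p \<le> J (p + t *\<^sub>R v)" by linarith
      then show ?thesis
        unfolding J_def add[OF pS tv] scale[OF v] d_def
        by (simp add: inner_add_left inner_add_right inner_commute power2_eq_square algebra_simps)
    qed
    \<comment> \<open>The vertex of the quadratic would be at \<open>- d / (v \<bullet> v)\<close>;
      adding 1 keeps the denominator positive without a case split, and the value at
      \<open>- d / w\<close> is still negative.\<close>
    define w where "w = v \<bullet> v + 1"
    have w: "w > 0" "v \<bullet> v < 2 * w" by (auto simp: w_def add_nonneg_pos add_pos_nonneg)
    have "2 * (- d / w) * d + (- d / w)\<^sup>2 * (v \<bullet> v) = (d / w)\<^sup>2 * (v \<bullet> v - 2 * w)"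
      using w(1) by (simp add: field_simps power2_eq_square)
    moreover have "(d / w)\<^sup>2 * (v \<bullet> v - 2 * w) < 0"
      using d w by (simp add: mult_pos_neg)
    ultimately show False using q[of "- d / w"] by linarith
  qed
  show thesis using that pS eq by blast
qed

text \<open>\<open>adjoint\<close> is defined by choice, so its identity requires some adjoint to
  exist; Riesz applied to \<open>\<lambda>x. H x \<bullet> y\<close> for each \<open>y\<close>
  supplies one.\<close>

lemma inner_adjoint:
  fixes H :: "'a::{real_inner, complete_space} \<Rightarrow> 'b::real_inner"
  assumes "bounded_linear H"
  shows "H x \<bullet> y = x \<bullet> adjoint H y"
proof -
  interpret bounded_linear H by fact
  have "\<exists>z. \<forall>x. H x \<bullet> y = x \<bullet> z" for y
  proof -
    have "\<bar>H x \<bullet> y\<bar> \<le> (onorm H * norm y) * norm x" for x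
    proof -
      have "\<bar>H x \<bullet> y\<bar> \<le> norm (H x) * norm y" by (rule Cauchy_Schwarz_ineq2)
      also have "\<dots> \<le> (onorm H * norm x) * norm y"
        by (intro mult_right_mono onorm assms) simp
      finally show ?thesis by (simp add: mult_ac)
    qed
    then obtain z where "\<And>x. H x \<bullet> y = z \<bullet> x"
      using riesz_on_closed_subspace[of UNIV "\<lambda>x. H x \<bullet> y" "onorm H * norm y"]
      by (auto simp: add scaleR inner_add_left)
    then show ?thesis by (metis inner_commute)
  qed
  then obtain g where "\<forall>x y. H x \<bullet> y = x \<bullet> g y" by metis
  then show ?thesis using adjoint_unique by metis
qed

text \<open>The projection is the Riesz representative in \<open>S\<close> of the functional
  \<open>\<lambda>x. z \<bullet> x\<close> restricted to \<open>S\<close>.\<close>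

lemma projection_on_closed_subspace:
  fixes S :: "'a::{real_inner, complete_space} set"
  assumes "subspace S" "closed S"
  obtains p where "p \<in> S" "\<And>x. x \<in> S \<Longrightarrow> (z - p) \<bullet> x = 0"
proof -
  obtain p where "p \<in> S" "\<And>x. x \<in> S \<Longrightarrow> z \<bullet> x = p \<bullet> x"
    using riesz_on_closed_subspace[of S "\<lambda>x. z \<bullet> x" "norm z"] assms
      Cauchy_Schwarz_ineq2[of z] by (auto simp: inner_add_right)
  then show thesis using that by (simp add: inner_diff_left)
qed

lemma Cauchy_of_halving_steps:
  fixes s :: "nat \<Rightarrow> 'a::real_normed_vector"
  assumes step: "\<And>n. norm (s (Suc n) - s n) \<le> C / 2 ^ n"
  shows "Cauchy s" and "norm (s n - s 0) \<le> 2 * C"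
proof -
  have C: "C \<ge> 0" using order_trans[OF norm_ge_zero step[of 0]] by simp
  \<comment> \<open>The right-hand side is the exact geometric sum of the step bounds from
    \<open>m\<close> to \<open>m + k - 1\<close>; the subtracted tail is what lets the induction
    close.\<close>
  have *: "norm (s (m + k) - s m) \<le> 2 * C / 2 ^ m - 2 * C / 2 ^ (m + k)" for m k
  proof (induction k)
    case (Suc k)
    have "norm (s (m + Suc k) - s m) \<le> norm (s (Suc (m + k)) - s (m + k)) + norm (s (m + k) - s m)"
      using norm_triangle_ineq[of "s (Suc (m + k)) - s (m + k)" "s (m + k) - s m"] by simp
    also have "\<dots> \<le> C / 2 ^ (m + k) + (2 * C / 2 ^ m - 2 * C / 2 ^ (m + k))"
      using step Suc by (intro add_mono) auto
    also have "\<dots> = 2 * C / 2 ^ m - 2 * C / 2 ^ (m + Suc k)"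
      by (simp add: field_simps)
    finally show ?case .
  qed simp
  have **: "norm (s (m + k) - s m) \<le> 2 * C / 2 ^ m" for m k
    using *[of m k] C by (smt (verit) divide_nonneg_nonneg zero_le_power)
  show "norm (s n - s 0) \<le> 2 * C" using **[of 0 n] by simp
  show "Cauchy s"
  proof (rule metric_CauchyI)
    fix e :: real assume e: "e > 0"
    have "(\<lambda>n. 2 * C * (1 / 2) ^ n) \<longlonglongrightarrow> 0"
      by (intro tendsto_mult_right_zero LIMSEQ_power_zero) simp
    then have "\<forall>\<^sub>F n in sequentially. 2 * C * (1 / 2) ^ n < e / 2"
      using e order_tendstoD(2) by (metis half_gt_zero)
    then obtain N where N: "2 * C / 2 ^ N < e / 2"
      by (auto simp: eventually_sequentially power_one_over)
    show "\<exists>M. \<forall>m\<ge>M. \<forall>n\<ge>M. dist (s m) (s n) < e"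
    proof (intro exI[of _ N] allI impI)
      fix m n assume "N \<le> m" "N \<le> n"
      then obtain a b where "m = N + a" "n = N + b" by (metis le_Suc_ex)
      then have "dist (s m) (s N) < e / 2" "dist (s n) (s N) < e / 2"
        using **[of N a] **[of N b] N by (auto simp: dist_norm)
      then show "dist (s m) (s n) < e" by (rule dist_triangle_half_l)
    qed
  qed
qed

subsection \<open>Open mapping and closed range theorems for closed linear relations\<close>

text \<open>The open mapping theorem, stated for a closed linear relation so that it applies to the
  graph of an unbounded, non-injective operator on a proper domain. The closed range is complete, so
  Baire category applies inside it.\<close>

lemma closed_relation_bounded_selection:
  fixes \<Gamma> :: "('a::{real_normed_vector, complete_space} \<times> 'b::{real_normed_vector, complete_space}) set"
  assumes cl: "closed \<Gamma>" and sub: "subspace \<Gamma>" and clr: "closed (snd ` \<Gamma>)"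
  obtains C where "C \<ge> 0" "\<And>k. k \<in> snd ` \<Gamma> \<Longrightarrow> \<exists>h. (h, k) \<in> \<Gamma> \<and> norm h \<le> C * norm k"
proof -
  define K where "K = snd ` \<Gamma>"
  have add: "(h + h', k + k') \<in> \<Gamma>" if "(h, k) \<in> \<Gamma>" "(h', k') \<in> \<Gamma>" for h k h' k'
    using subspace_add[OF sub that] by simp
  have scale: "(c *\<^sub>R h, c *\<^sub>R k) \<in> \<Gamma>" if "(h, k) \<in> \<Gamma>" for c h k
    using subspace_scale[OF sub that] by simp
  have subK: "subspace K"
    unfolding K_def by (intro linear_subspace_image sub) (auto intro!: linearI)
  define A where "A n = closure {k. \<exists>h. (h, k) \<in> \<Gamma> \<and> norm h \<le> real n}" for n :: nat
  have AK: "A n \<subseteq> K" for n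
    unfolding A_def K_def by (rule closure_minimal[OF _ clr]) force
  \<comment> \<open>The closed sets \<open>A n\<close> cover the complete space \<open>K\<close>; by
    Baire they cannot all have empty interior relative to \<open>K\<close>.\<close>
  have "\<exists>n. top_of_set K interior_of A n \<noteq> {}"
  proof (rule ccontr)
    assume "\<not> ?thesis"
    moreover have "completely_metrizable_space (top_of_set K)"
      using clr unfolding K_def
      by (intro completely_metrizable_space_closedin completely_metrizable_space_euclidean) simp
    moreover have "closedin (top_of_set K) (A n)" for n
      using AK by (intro closed_subset) (auto simp: A_def)
    ultimately have "top_of_set K interior_of \<Union>(range A) = {}"
      by (intro Baire_category_alt) auto
    moreover have "K \<subseteq> \<Union>(range A)"
    proof
      fix k assume "k \<in> K"
      then obtain h where h: "(h, k) \<in> \<Gamma>" unfolding K_def by auto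
      obtain n where "norm h \<le> real n" using real_arch_simple by blast
      then have "k \<in> A n" unfolding A_def using h closure_subset by fastforce
      then show "k \<in> \<Union>(range A)" by blast
    qed
    then have "\<Union>(range A) = K" using AK by blast
    ultimately have "K = {}"
      using interior_of_topspace[of "top_of_set K"] by simp
    then show False using subspace_0[OF subK] by blast
  qed
  then obtain n k0 where "k0 \<in> top_of_set K interior_of A n" by blast
  then obtain U where U: "openin (top_of_set K) U" "k0 \<in> U" "U \<subseteq> A n"
    by (auto simp: interior_of_def)
  then obtain e where e: "e > 0" and ball: "\<And>k. k \<in> K \<Longrightarrow> dist k k0 < e \<Longrightarrow> k \<in> A n"
    unfolding openin_euclidean_subtopology_iff by blast
  have k0: "k0 \<in> K" using U openin_subset by fastforce
  have approx: "\<exists>h k'. (h, k') \<in> \<Gamma> \<and> norm h \<le> real n \<and> norm (k - k') < d"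
    if k: "k \<in> A n" "d > 0" for k d
  proof -
    obtain k' where "\<exists>h. (h, k') \<in> \<Gamma> \<and> norm h \<le> real n" "dist k' k < d"
      using k unfolding A_def closure_approachable by blast
    then show ?thesis by (metis dist_commute dist_norm)
  qed
  \<comment> \<open>Differences of points near \<open>k0\<close> move the interior point of \<open>A n\<close> to the origin.\<close>
  have small: "\<exists>h k'. (h, k') \<in> \<Gamma> \<and> norm h \<le> 2 * real n \<and> norm (k - k') < d"
    if k: "k \<in> K" "norm k < e" and d: "d > 0" for k d
  proof -
    have "k0 + k \<in> A n" using k k0 subK by (intro ball) (auto simp: subspace_add dist_norm)
    then obtain h1 k1 where 1: "(h1, k1) \<in> \<Gamma>" "norm h1 \<le> real n" "norm (k0 + k - k1) < d / 2"
      using approx[of "k0 + k" "d / 2"] d by auto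
    have "k0 \<in> A n" using k0 e by (intro ball) auto
    then obtain h2 k2 where 2: "(h2, k2) \<in> \<Gamma>" "norm h2 \<le> real n" "norm (k0 - k2) < d / 2"
      using approx[of k0 "d / 2"] d by auto
    have "(h1 - h2, k1 - k2) \<in> \<Gamma>" using subspace_diff[OF sub 1(1) 2(1)] by simp
    moreover have "norm (h1 - h2) \<le> 2 * real n"
      using norm_triangle_ineq4[of h1 h2] 1 2 by linarith
    moreover have "norm (k - (k1 - k2)) < d"
      using norm_triangle_ineq4[of "k0 + k - k1" "k0 - k2"] 1 2 by (simp add: algebra_simps)
    ultimately show ?thesis by blast
  qed
  \<comment> \<open>For nonzero \<open>k\<close>, scaling by \<open>t = e / (2 * norm k)\<close>
    gives norm \<open>e / 2\<close>, within reach of \<open>small\<close>. Scaling back turns the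
    error \<open>e / 4\<close> into \<open>norm k / 2\<close> and the bound
    \<open>2 * real n\<close> into \<open>M * norm k\<close>.\<close>
  define M where "M = 4 * real n / e"
  have M: "M \<ge> 0" using e by (simp add: M_def)
  have "\<exists>g. g \<in> \<Gamma> \<and> norm (fst g) \<le> M * norm k \<and> norm (k - snd g) \<le> norm k / 2"
    if k: "k \<in> K" for k
  proof (cases "k = 0")
    case True
    then show ?thesis using subspace_0[OF sub] by (intro exI[of _ 0]) auto
  next
    case False
    define t where "t = e / (2 * norm k)"
    have t: "t > 0" using False e by (simp add: t_def)
    have "norm (t *\<^sub>R k) < e" using False e by (simp add: t_def)
    then obtain h k' where hk: "(h, k') \<in> \<Gamma>" "norm h \<le> 2 * real n" "norm (t *\<^sub>R k - k') < e / 4"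
      using small[of "t *\<^sub>R k" "e / 4"] k e subK by (auto simp: subspace_scale)
    have "norm (inverse t *\<^sub>R h) \<le> M * norm k"
    proof -
      have "norm (inverse t *\<^sub>R h) = inverse t * norm h" using t by simp
      also have "\<dots> \<le> inverse t * (2 * real n)" using hk t by (intro mult_left_mono) auto
      also have "\<dots> = M * norm k" using False e by (simp add: t_def M_def)
      finally show ?thesis .
    qed
    moreover have "norm (k - inverse t *\<^sub>R k') \<le> norm k / 2"
    proof -
      have "k - inverse t *\<^sub>R k' = inverse t *\<^sub>R (t *\<^sub>R k - k')"
        using t by (simp add: scaleR_diff_right)
      then have "norm (k - inverse t *\<^sub>R k') = inverse t * norm (t *\<^sub>R k - k')" using t by simp
      also have "\<dots> \<le> inverse t * (e / 4)" using hk t by (intro mult_left_mono) auto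
      also have "\<dots> = norm k / 2" using False e by (simp add: t_def)
      finally show ?thesis .
    qed
    ultimately show ?thesis using scale[OF hk(1), of "inverse t"]
      by (intro exI[of _ "(inverse t *\<^sub>R h, inverse t *\<^sub>R k')"]) auto
  qed
  then obtain g where g: "\<And>k. k \<in> K \<Longrightarrow> g k \<in> \<Gamma>"
    "\<And>k. k \<in> K \<Longrightarrow> norm (fst (g k)) \<le> M * norm k"
    "\<And>k. k \<in> K \<Longrightarrow> norm (k - snd (g k)) \<le> norm k / 2" by metis
  \<comment> \<open>Successive approximation: each step halves the residual, and closedness of \<open>\<Gamma>\<close> gives the limit.\<close>
  have "\<exists>h. (h, k) \<in> \<Gamma> \<and> norm h \<le> (2 * M) * norm k" if k: "k \<in> K" for k
  proof -
    define r where "r = rec_nat k (\<lambda>_ r. r - snd (g r))"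
    have r0: "r 0 = k" and rS: "r (Suc j) = r j - snd (g (r j))" for j
      by (simp_all add: r_def)
    have rK: "r j \<in> K" for j
      by (induction j) (use k g subK in \<open>auto simp: r0 rS K_def intro!: subspace_diff\<close>)
    have rn: "norm (r j) \<le> norm k / 2 ^ j" for j
    proof (induction j)
      case (Suc j)
      then show ?case using g(3)[OF rK, of j] by (simp add: rS)
    qed (simp add: r0)
    define s where "s j = (\<Sum>i<j. g (r i))" for j
    have s\<Gamma>: "s j \<in> \<Gamma>" for j
      unfolding s_def by (intro subspace_sum[OF sub] g rK)
    have snds: "snd (s j) = k - r j" for j
      by (induction j) (simp_all add: s_def r0 rS)
    have step: "norm (fst (s (Suc j)) - fst (s j)) \<le> (M * norm k) / 2 ^ j" for j
    proof -
      have "norm (fst (s (Suc j)) - fst (s j)) = norm (fst (g (r j)))" by (simp add: s_def)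
      also have "\<dots> \<le> M * norm (r j)" by (intro g rK)
      also have "\<dots> \<le> M * (norm k / 2 ^ j)" using rn M by (intro mult_left_mono) auto
      finally show ?thesis by simp
    qed
    obtain h where h: "(\<lambda>j. fst (s j)) \<longlonglongrightarrow> h"
      using Cauchy_of_halving_steps(1)[of "\<lambda>j. fst (s j)", OF step] Cauchy_convergent convergent_def
      by blast
    have "r \<longlonglongrightarrow> 0"
    proof (rule Lim_null_comparison)
      show "\<forall>\<^sub>F j in sequentially. norm (r j) \<le> norm k * (1 / 2) ^ j"
        using rn by (simp add: power_one_over)
      show "(\<lambda>j. norm k * (1 / 2) ^ j) \<longlonglongrightarrow> 0"
        by (intro tendsto_mult_right_zero LIMSEQ_power_zero) simp
    qed
    then have "(\<lambda>j. snd (s j)) \<longlonglongrightarrow> k"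
      unfolding snds using tendsto_diff[OF tendsto_const[of k]] by fastforce
    with h have "(\<lambda>j. (fst (s j), snd (s j))) \<longlonglongrightarrow> (h, k)" by (rule tendsto_Pair)
    then have "s \<longlonglongrightarrow> (h, k)" by simp
    then have "(h, k) \<in> \<Gamma>" by (rule closed_sequentially[OF cl s\<Gamma>])
    moreover have "norm h \<le> 2 * (M * norm k)"
    proof (rule Lim_norm_ubound[OF _ h])
      have "fst (s 0) = 0" by (simp add: s_def)
      then show "\<forall>\<^sub>F j in sequentially. norm (fst (s j)) \<le> 2 * (M * norm k)"
        using Cauchy_of_halving_steps(2)[of "\<lambda>j. fst (s j)", OF step] by simp
    qed simp
    ultimately show ?thesis by (auto simp: mult.assoc)
  qed
  then show thesis using that[of "2 * M"] M unfolding K_def by simp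
qed

text \<open>Since \<open>l\<close> annihilates everything related to 0, \<open>l \<bullet> h\<close>
  depends only on \<open>k\<close>. The bounded selection makes it a continuous functional of
  \<open>k\<close> on the closed range, where Riesz represents it.\<close>

lemma closed_range_representation:
  fixes \<Gamma> :: "('a::{real_inner, complete_space} \<times> 'b::{real_inner, complete_space}) set"
  assumes cl: "closed \<Gamma>" and sub: "subspace \<Gamma>" and clr: "closed (snd ` \<Gamma>)"
    and ker: "\<And>h. (h, 0) \<in> \<Gamma> \<Longrightarrow> l \<bullet> h = 0"
  shows "\<exists>p\<in>snd ` \<Gamma>. \<forall>(h, k)\<in>\<Gamma>. l \<bullet> h = p \<bullet> k"
proof -
  obtain C where C: "C \<ge> 0" "\<And>k. k \<in> snd ` \<Gamma> \<Longrightarrow> \<exists>h. (h, k) \<in> \<Gamma> \<and> norm h \<le> C * norm k"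
    using closed_relation_bounded_selection[OF cl sub clr] by metis
  define f where "f k = l \<bullet> (SOME h. (h, k) \<in> \<Gamma>)" for k
  have f: "f k = l \<bullet> h" if "(h, k) \<in> \<Gamma>" for h k
  proof -
    define h' where "h' = (SOME h. (h, k) \<in> \<Gamma>)"
    have "(h', k) \<in> \<Gamma>" unfolding h'_def using that by (rule someI)
    then have "(h' - h, 0) \<in> \<Gamma>" using subspace_diff[OF sub _ that] by fastforce
    from ker[OF this] show ?thesis by (simp add: f_def h'_def inner_diff_right)
  qed
  have subK: "subspace (snd ` \<Gamma>)"
    by (intro linear_subspace_image sub) (auto intro!: linearI)
  obtain p where p: "p \<in> snd ` \<Gamma>" "\<And>k. k \<in> snd ` \<Gamma> \<Longrightarrow> f k = p \<bullet> k"
  proof (rule riesz_on_closed_subspace[OF subK clr, of f "norm l * C"])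
    fix k k' assume "k \<in> snd ` \<Gamma>" "k' \<in> snd ` \<Gamma>"
    then obtain h h' where *: "(h, k) \<in> \<Gamma>" "(h', k') \<in> \<Gamma>" by auto
    then have "(h + h', k + k') \<in> \<Gamma>" using subspace_add[OF sub *] by simp
    then show "f (k + k') = f k + f k'" using * by (simp add: f inner_add_right)
  next
    fix c k assume "k \<in> snd ` \<Gamma>"
    then obtain h where *: "(h, k) \<in> \<Gamma>" by auto
    then have "(c *\<^sub>R h, c *\<^sub>R k) \<in> \<Gamma>" using subspace_scale[OF sub *, of c] by simp
    then show "f (c *\<^sub>R k) = c * f k" using * by (simp add: f)
  next
    fix k assume "k \<in> snd ` \<Gamma>"
    then obtain h where h: "(h, k) \<in> \<Gamma>" "norm h \<le> C * norm k" using C by blast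
    have "\<bar>f k\<bar> \<le> norm l * norm h" using h Cauchy_Schwarz_ineq2[of l h] by (simp add: f)
    also have "\<dots> \<le> norm l * (C * norm k)" using h by (intro mult_left_mono) auto
    finally show "\<bar>f k\<bar> \<le> norm l * C * norm k" by simp
  qed blast
  have "l \<bullet> h = p \<bullet> k" if "(h, k) \<in> \<Gamma>" for h k
    using f[OF that] p(2)[of k] image_eqI[OF _ that, of k snd] by simp
  then show ?thesis using p(1) by blast
qed

subsection \<open>Closed operators with a bounded observation\<close>

lemma inner_dense_eqI:
  fixes z :: "'a::real_inner"
  assumes "closure D = UNIV" "\<And>x. x \<in> D \<Longrightarrow> x \<bullet> z = x \<bullet> z'"
  shows "z = z'"
proof -
  have "closed {x. x \<bullet> z = x \<bullet> z'}" by (intro closed_Collect_eq continuous_intros)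
  then have "closure D \<subseteq> {x. x \<bullet> z = x \<bullet> z'}" using assms(2) by (intro closure_minimal) auto
  then have "(z - z') \<bullet> z = (z - z') \<bullet> z'" using assms(1) by blast
  then show ?thesis by (metis inner_diff_right inner_eq_zero_iff right_minus_eq)
qed

lemma adj_eqI:
  assumes "closure D = UNIV" "\<And>x. x \<in> D \<Longrightarrow> L x \<bullet> q = x \<bullet> z"
  shows "adj D L q = z"
  unfolding adj_def using assms by (intro the_equality inner_dense_eqI[OF assms(1)]) auto

lemma inner_adj:
  assumes "closure D = UNIV" "q \<in> adj_dom D L" "x \<in> D"
  shows "L x \<bullet> q = x \<bullet> adj D L q"
  using assms adj_eqI[OF assms(1), of L q] unfolding adj_dom_def by force

section \<open>The joint operator taking x to (L x, H x) and its normal equations\<close>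

locale observed_operator =
  fixes D :: "'h::{real_inner, complete_space} set"
    and L :: "'h \<Rightarrow> 'f::{real_inner, complete_space}"
    and H :: "'h \<Rightarrow> 'y::{real_inner, complete_space}"
  assumes operator: "closed_dense_operator D L"
    and observation: "bounded_linear H"
begin

lemma subspace_domain: "subspace D"
  and dense_domain: "closure D = UNIV"
  and closed_graph: "closed ((\<lambda>x. (x, L x)) ` D)"
  using operator by (auto simp: closed_dense_operator_def)

lemma L_add: "x \<in> D \<Longrightarrow> x' \<in> D \<Longrightarrow> L (x + x') = L x + L x'"
  and L_scale: "x \<in> D \<Longrightarrow> L (c *\<^sub>R x) = c *\<^sub>R L x"
  using operator by (auto simp: closed_dense_operator_def)

lemma L_diff: "x \<in> D \<Longrightarrow> x' \<in> D \<Longrightarrow> L (x - x') = L x - L x'"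
  using L_add[of "x - x'" x'] subspace_diff[OF subspace_domain] by (simp add: algebra_simps)

lemma L_zero: "L 0 = 0"
  using L_scale[of 0 0] subspace_0[OF subspace_domain] by simp

lemmas D_add = subspace_add[OF subspace_domain]
  and D_diff = subspace_diff[OF subspace_domain]
  and D_scale = subspace_scale[OF subspace_domain]
  and D_zero = subspace_0[OF subspace_domain]

sublocale H: bounded_linear H by (rule observation)

lemma subspace_graph: "subspace ((\<lambda>x. (x, L x)) ` D)"
  by (rule subspaceI) (auto simp: image_iff L_add L_scale L_zero D_add D_scale D_zero zero_prod_def)

lemma subspace_joint_graph: "subspace ((\<lambda>x. (x, L x, H x)) ` D)"
  by (rule subspaceI)
    (auto simp: image_iff L_add L_scale L_zero D_add D_scale D_zero H.add H.scaleR H.zero zero_prod_def)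

lemma subspace_joint_range: "subspace ((\<lambda>x. (L x, H x)) ` D)"
proof -
  have "subspace (snd ` (\<lambda>x. (x, L x, H x)) ` D)"
    by (intro linear_subspace_image subspace_joint_graph) (auto intro!: linearI)
  then show ?thesis by (simp add: image_image)
qed

text \<open>Closedness survives the added component: the set is the preimage of the closed graph of
  \<open>L\<close> cut by the closed condition \<open>b = H x\<close>.\<close>

lemma closed_joint_graph: "closed ((\<lambda>x. (x, L x, H x)) ` D)"
proof -
  have "closed ((\<lambda>(x, a, b). (x, a)) -` ((\<lambda>x. (x, L x)) ` D) \<inter> {(x, a, b). b = H x})"
    unfolding case_prod_beta
  proof (intro closed_Int closed_vimage closed_graph closed_Collect_eq)
    show "continuous_on UNIV (\<lambda>z. H (fst z))" by (intro H.continuous_on continuous_intros)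
  qed (intro continuous_intros)+
  also have "(\<lambda>(x, a, b). (x, a)) -` ((\<lambda>x. (x, L x)) ` D) \<inter> {(x, a, b). b = H x}
      = (\<lambda>x. (x, L x, H x)) ` D"
    by (auto simp: image_iff)
  finally show ?thesis .
qed

text \<open>For a limit \<open>(f, g)\<close> of pairs from the range, write \<open>f = L v\<close>.
  The open mapping theorem for \<open>L\<close> corrects \<open>x n - v\<close> by vectors
  \<open>a n\<close> tending to 0 so that it falls into the kernel of \<open>L\<close>; closedness
  of the image of that kernel under \<open>H\<close> then absorbs \<open>g - H v\<close>.\<close>

lemma closed_joint_range:
  assumes "closed (L ` D)" and "closed (H ` {x\<in>D. L x = 0})"
  shows "closed ((\<lambda>x. (L x, H x)) ` D)"
  unfolding closed_sequential_limits
proof (intro allI impI, elim conjE)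
  fix k z assume k: "\<forall>n. k n \<in> (\<lambda>x. (L x, H x)) ` D" and lim: "k \<longlonglongrightarrow> z"
  obtain f g where z: "z = (f, g)" by (cases z)
  from k obtain x where x: "\<And>n. x n \<in> D" "\<And>n. k n = (L (x n), H (x n))"
    unfolding image_iff by metis
  have Lx: "(\<lambda>n. L (x n)) \<longlonglongrightarrow> f" and Hx: "(\<lambda>n. H (x n)) \<longlonglongrightarrow> g"
    using tendsto_fst[OF lim] tendsto_snd[OF lim] by (simp_all add: x z)
  have "f \<in> L ` D" using closed_sequentially[OF assms(1) _ Lx] x by blast
  then obtain v where v: "v \<in> D" "f = L v" by blast
  obtain C where C: "\<And>a. a \<in> L ` D \<Longrightarrow> \<exists>h. h \<in> D \<and> L h = a \<and> norm h \<le> C * norm a"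
    using closed_relation_bounded_selection[OF closed_graph subspace_graph]
    by (simp add: image_image image_iff assms) metis
  have "\<exists>h. h \<in> D \<and> L h = L (x n - v) \<and> norm h \<le> C * norm (L (x n) - f)" for n
    using C[OF imageI[OF D_diff[OF x(1)[of n] v(1)]]] x(1)[of n] v by (simp add: L_diff)
  then obtain a where a: "\<And>n. a n \<in> D" "\<And>n. L (a n) = L (x n - v)"
    "\<And>n. norm (a n) \<le> C * norm (L (x n) - f)" by metis
  have "a \<longlonglongrightarrow> 0"
  proof (rule Lim_null_comparison)
    show "\<forall>\<^sub>F n in sequentially. norm (a n) \<le> C * norm (L (x n) - f)" using a by simp
    show "(\<lambda>n. C * norm (L (x n) - f)) \<longlonglongrightarrow> 0"
      using Lx by (intro tendsto_mult_right_zero tendsto_norm_zero) (simp add: LIM_zero)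
  qed
  then have "(\<lambda>n. H (x n) - H v - H (a n)) \<longlonglongrightarrow> g - H v - H 0"
    by (intro tendsto_diff Hx tendsto_const H.tendsto)
  moreover have "H (x n) - H v - H (a n) \<in> H ` {x\<in>D. L x = 0}" for n
  proof
    show "H (x n) - H v - H (a n) = H (x n - v - a n)" by (simp add: H.diff)
    show "x n - v - a n \<in> {x\<in>D. L x = 0}" using x v a by (simp add: D_diff L_diff)
  qed
  ultimately have "g - H v - H 0 \<in> H ` {x\<in>D. L x = 0}"
    by (rule closed_sequentially[OF assms(2), rotated])
  then obtain b where "b \<in> D" "L b = 0" "g - H v = H b" by (auto simp: H.zero)
  then have "z = (L (v + b), H (v + b))" "v + b \<in> D"
    using v by (simp_all add: z L_add H.add D_add algebra_simps)
  then show "z \<in> (\<lambda>x. (L x, H x)) ` D" by blast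
qed

text \<open>Testing the adjoint equation against the dense domain removes both adjoints. What
  remains says that \<open>(0, y) - (L \<phi>, H \<phi>)\<close> is orthogonal to the joint
  range.\<close>

lemma estimation_equations_iff:
  "estimation_equations D L H y \<phi> q \<longleftrightarrow>
     \<phi> \<in> D \<and> q = L \<phi> \<and> (\<forall>x\<in>D. L \<phi> \<bullet> L x = (y - H \<phi>) \<bullet> H x)"
proof (cases "\<phi> \<in> D \<and> q = L \<phi>")
  case True
  have H_adj: "x \<bullet> adjoint H (y - H \<phi>) = (y - H \<phi>) \<bullet> H x" for x
    by (metis inner_adjoint[OF observation] inner_commute)
  have "q \<in> adj_dom D L \<and> adj D L q = adjoint H (y - H \<phi>) \<longleftrightarrow>
      (\<forall>x\<in>D. L x \<bullet> q = x \<bullet> adjoint H (y - H \<phi>))"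
    using inner_adj[OF dense_domain, of q L] adj_eqI[OF dense_domain, of L q]
    by (auto simp: adj_dom_def)
  then show ?thesis using True by (auto simp: estimation_equations_def H_adj inner_commute)
qed (auto simp: estimation_equations_def)

text \<open>The residual at \<open>\<phi>\<close> is orthogonal to \<open>(L z, H z)\<close>, so the
  squares add. Orthogonality to \<open>(L \<phi>, H \<phi>)\<close> itself reduces the squared norm
  of the residual to \<open>y \<bullet> (y - H \<phi>)\<close>.\<close>

lemma apost_set_centered:
  assumes eqs: "estimation_equations D L H y \<phi> q"
    and G: "G = {(f, \<eta>). (norm f)\<^sup>2 + (norm \<eta>)\<^sup>2 \<le> 1}"
  shows "apost_set D L H G y =
    (\<lambda>z. \<phi> + z) ` {z\<in>D. (norm (L z, H z))\<^sup>2 \<le> 1 - y \<bullet> (y - H \<phi>)}"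
proof -
  have \<phi>: "\<phi> \<in> D" and orth: "\<And>x. x \<in> D \<Longrightarrow> L \<phi> \<bullet> L x = (y - H \<phi>) \<bullet> H x"
    using eqs by (auto simp: estimation_equations_iff)
  have "(norm (L (\<phi> + z)))\<^sup>2 + (norm (y - H (\<phi> + z)))\<^sup>2
      = (norm (L z, H z))\<^sup>2 + y \<bullet> (y - H \<phi>)" if z: "z \<in> D" for z
    using orth[OF \<phi>] orth[OF z]
    by (simp add: L_add[OF \<phi> z] H.add norm_Pair power2_norm_eq_inner inner_add_left
        inner_add_right inner_diff_left inner_diff_right inner_commute algebra_simps)
  then have "\<phi> + z \<in> apost_set D L H G y \<longleftrightarrow>
      z \<in> {z\<in>D. (norm (L z, H z))\<^sup>2 \<le> 1 - y \<bullet> (y - H \<phi>)}" for z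
    using D_diff[of "\<phi> + z" \<phi>] \<phi> by (auto simp: apost_set_def G D_add le_diff_eq)
  then show ?thesis
    by (auto simp: image_iff) (metis add_diff_cancel_left' diff_add_cancel)
qed

end

locale closed_range_observed_operator = observed_operator +
  assumes closed_range: "closed ((\<lambda>x. (L x, H x)) ` D)"
begin

lemma estimation_equations_solvable: "\<exists>\<phi> q. estimation_equations D L H y \<phi> q"
proof -
  obtain p where p: "p \<in> (\<lambda>x. (L x, H x)) ` D"
    "\<And>k. k \<in> (\<lambda>x. (L x, H x)) ` D \<Longrightarrow> ((0, y) - p) \<bullet> k = 0"
    using projection_on_closed_subspace[OF subspace_joint_range closed_range] by metis
  then obtain \<phi> where \<phi>: "\<phi> \<in> D" "p = (L \<phi>, H \<phi>)" by blast
  have "L \<phi> \<bullet> L x = (y - H \<phi>) \<bullet> H x" if "x \<in> D" for x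
    using p(2)[of "(L x, H x)"] that \<phi> by (auto simp: inner_diff_left)
  then show ?thesis using \<phi> estimation_equations_iff by blast
qed

lemma representation:
  assumes "\<And>x. x \<in> D \<Longrightarrow> L x = 0 \<Longrightarrow> H x = 0 \<Longrightarrow> l \<bullet> x = 0"
  shows "\<exists>p\<in>D. \<forall>x\<in>D. l \<bullet> x = L p \<bullet> L x + H p \<bullet> H x"
proof -
  let ?\<Gamma> = "(\<lambda>x. (x, L x, H x)) ` D"
  have "closed (snd ` ?\<Gamma>)" using closed_range by (simp add: image_image)
  moreover have "l \<bullet> h = 0" if "(h, 0) \<in> ?\<Gamma>" for h
    using that assms by (auto simp: zero_prod_def)
  ultimately have "\<exists>k\<in>snd ` ?\<Gamma>. \<forall>(h, k')\<in>?\<Gamma>. l \<bullet> h = k \<bullet> k'"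
    by (rule closed_range_representation[OF closed_joint_graph subspace_joint_graph])
  then show ?thesis by simp
qed

text \<open>From left to right, an arbitrary pair \<open>(q, u)\<close> is replaced by one in the
  joint range: \<open>l\<close> vanishes on the common kernel, so \<open>representation\<close>
  applies. Conversely, \<open>q = L p\<close> and \<open>u = H p\<close> serve, the identity itself
  placing \<open>L p\<close> in the adjoint domain.\<close>

lemma in_sum_of_adjoint_ranges_iff:
  "l \<in> {a + b | a b. a \<in> adj D L ` adj_dom D L \<and> b \<in> range (adjoint H)} \<longleftrightarrow>
     (\<exists>p\<in>D. \<forall>x\<in>D. l \<bullet> x = L p \<bullet> L x + H p \<bullet> H x)"
proof
  assume "l \<in> {a + b | a b. a \<in> adj D L ` adj_dom D L \<and> b \<in> range (adjoint H)}"
  then obtain q u where q: "q \<in> adj_dom D L" and l: "l = adj D L q + adjoint H u" by blast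
  have "l \<bullet> x = q \<bullet> L x + u \<bullet> H x" if "x \<in> D" for x
    using inner_adj[OF dense_domain q that] inner_adjoint[OF observation, of x u]
    by (simp add: l inner_add_left inner_add_right inner_commute)
  then have "\<And>x. x \<in> D \<Longrightarrow> L x = 0 \<Longrightarrow> H x = 0 \<Longrightarrow> l \<bullet> x = 0" by simp
  then show "\<exists>p\<in>D. \<forall>x\<in>D. l \<bullet> x = L p \<bullet> L x + H p \<bullet> H x"
    by (rule representation)
next
  assume "\<exists>p\<in>D. \<forall>x\<in>D. l \<bullet> x = L p \<bullet> L x + H p \<bullet> H x"
  then obtain p where p: "p \<in> D" "\<And>x. x \<in> D \<Longrightarrow> l \<bullet> x = L p \<bullet> L x + H p \<bullet> H x" by blast
  have *: "L x \<bullet> L p = x \<bullet> (l - adjoint H (H p))" if "x \<in> D" for x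
    using p(2)[OF that] inner_adjoint[OF observation, of x "H p"]
    by (simp add: inner_diff_right inner_commute)
  then have "L p \<in> adj_dom D L" and "adj D L (L p) = l - adjoint H (H p)"
    using adj_eqI[OF dense_domain, of L "L p"] by (auto simp: adj_dom_def)
  then have "l - adjoint H (H p) \<in> adj D L ` adj_dom D L" by (metis image_eqI)
  moreover have "l = (l - adjoint H (H p)) + adjoint H (H p)" by simp
  ultimately show "l \<in> {a + b | a b. a \<in> adj D L ` adj_dom D L \<and> b \<in> range (adjoint H)}"
    by blast
qed

end

subsection \<open>A posteriori and a priori errors\<close>

text \<open>As \<open>z\<close> and \<open>- z\<close> are both available, the sign of
  \<open>l \<bullet> z\<close> can be chosen so that the two deviations add up; the offset from the
  centre then separates from the supremum.\<close>

lemma worst_dev_symmetric: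
  fixes l :: "'h::real_inner"
  assumes Z: "Z \<noteq> {}" "\<forall>z\<in>Z. - z \<in> Z"
  shows "worst_dev ((+) \<phi>0 ` Z) l \<phi> =
    ereal \<bar>l \<bullet> (\<phi> - \<phi>0)\<bar> + (SUP z\<in>Z. ereal \<bar>l \<bullet> z\<bar>)"
proof -
  let ?a = "l \<bullet> (\<phi> - \<phi>0)"
  have "worst_dev ((+) \<phi>0 ` Z) l \<phi> = (SUP z\<in>Z. ereal \<bar>?a - l \<bullet> z\<bar>)"
    by (simp add: worst_dev_def image_image inner_add_right inner_diff_right algebra_simps)
  also have "\<dots> = (SUP z\<in>Z. ereal \<bar>?a\<bar> + ereal \<bar>l \<bullet> z\<bar>)"
  proof (rule antisym)
    show "(SUP z\<in>Z. ereal \<bar>?a - l \<bullet> z\<bar>) \<le> (SUP z\<in>Z. ereal \<bar>?a\<bar> + ereal \<bar>l \<bullet> z\<bar>)"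
      by (intro SUP_mono) (auto intro!: bexI)
    show "(SUP z\<in>Z. ereal \<bar>?a\<bar> + ereal \<bar>l \<bullet> z\<bar>) \<le> (SUP z\<in>Z. ereal \<bar>?a - l \<bullet> z\<bar>)"
    proof (rule SUP_mono)
      fix z assume z: "z \<in> Z"
      have "\<bar>?a\<bar> + \<bar>l \<bullet> z\<bar> \<le> \<bar>?a - l \<bullet> z\<bar> \<or> \<bar>?a\<bar> + \<bar>l \<bullet> z\<bar> \<le> \<bar>?a - l \<bullet> (- z)\<bar>"
        unfolding inner_minus_right by linarith
      then show "\<exists>z'\<in>Z. ereal \<bar>?a\<bar> + ereal \<bar>l \<bullet> z\<bar> \<le> ereal \<bar>?a - l \<bullet> z'\<bar>"
        using z Z(2) by (metis ereal_less_eq(3) plus_ereal.simps(1))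
    qed
  qed
  also have "\<dots> = ereal \<bar>?a\<bar> + (SUP z\<in>Z. ereal \<bar>l \<bullet> z\<bar>)"
    using Z(1) by (intro SUP_ereal_add_right) auto
  finally show ?thesis .
qed

text \<open>The centre \<open>\<phi>0\<close> belongs to the set because \<open>0 \<in> Z\<close>,
  and there the offset term vanishes.\<close>

lemma apost_error_symmetric:
  fixes l :: "'h::real_inner"
  assumes Z: "0 \<in> Z" "\<forall>z\<in>Z. - z \<in> Z"
  shows "apost_error ((+) \<phi>0 ` Z) l = (SUP z\<in>Z. ereal \<bar>l \<bullet> z\<bar>)"
proof -
  have Z': "Z \<noteq> {}" using Z(1) by blast
  have "apost_error ((+) \<phi>0 ` Z) l =
      (INF \<phi>\<in>(+) \<phi>0 ` Z. ereal \<bar>l \<bullet> (\<phi> - \<phi>0)\<bar> + (SUP z\<in>Z. ereal \<bar>l \<bullet> z\<bar>))"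
    unfolding apost_error_def by (intro INF_cong refl worst_dev_symmetric Z' Z)
  also have "\<dots> = (SUP z\<in>Z. ereal \<bar>l \<bullet> z\<bar>)"
  proof (rule antisym)
    show "(INF \<phi>\<in>(+) \<phi>0 ` Z. ereal \<bar>l \<bullet> (\<phi> - \<phi>0)\<bar> + (SUP z\<in>Z. ereal \<bar>l \<bullet> z\<bar>))
        \<le> (SUP z\<in>Z. ereal \<bar>l \<bullet> z\<bar>)"
      using Z(1) by (intro INF_lower2[of \<phi>0]) (auto simp: zero_ereal_def[symmetric] intro!: image_eqI[of _ _ 0])
    show "(SUP z\<in>Z. ereal \<bar>l \<bullet> z\<bar>)
        \<le> (INF \<phi>\<in>(+) \<phi>0 ` Z. ereal \<bar>l \<bullet> (\<phi> - \<phi>0)\<bar> + (SUP z\<in>Z. ereal \<bar>l \<bullet> z\<bar>))"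
      by (intro INF_greatest ereal_le_add_self2) simp
  qed
  finally show ?thesis .
qed

text \<open>A finite supremum can be cancelled, forcing the offset
  \<open>l \<bullet> (\<phi> - \<phi>0)\<close> to be zero. Only the component along
  \<open>l\<close> is determined.\<close>

lemma minimax_apost_est_symmetric:
  fixes l :: "'h::real_inner"
  assumes Z: "0 \<in> Z" "\<forall>z\<in>Z. - z \<in> Z"
  shows "minimax_apost_est ((+) \<phi>0 ` Z) l \<phi> \<longleftrightarrow>
    (SUP z\<in>Z. ereal \<bar>l \<bullet> z\<bar>) \<noteq> \<infinity> \<and> l \<bullet> \<phi> = l \<bullet> \<phi>0"
proof -
  have Z': "Z \<noteq> {}" using Z(1) by blast
  \<comment> \<open>This excludes minus infinity, so finiteness of the error reduces to being
    different from infinity.\<close>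
  have "0 \<le> (SUP z\<in>Z. ereal \<bar>l \<bullet> z\<bar>)"
    using Z(1) by (intro SUP_upper2[of 0]) auto
  then show ?thesis
    unfolding minimax_apost_est_def
      apost_error_symmetric[OF Z] worst_dev_symmetric[OF Z' Z(2)]
    by (cases "SUP z\<in>Z. ereal \<bar>l \<bullet> z\<bar>") (auto simp: inner_diff_right)
qed

section \<open>Mean squares over the admissible noises\<close>

text \<open>The values \<open>e\<close> and \<open>- e\<close> with equal probability have mean
  zero, which removes the cross term. With \<open>e\<close> along \<open>v\<close> this attains the
  bound of the next lemma.\<close>

lemma two_point_noise:
  fixes e :: "'y::real_inner"
  assumes "norm e \<le> 1"
  obtains M \<eta> where "(M, \<eta>) \<in> noises"
    "\<And>a v. (\<integral>w. (a - v \<bullet> \<eta> w)\<^sup>2 \<partial>M) = a\<^sup>2 + (v \<bullet> e)\<^sup>2"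
proof
  let ?P = "map_pmf (\<lambda>b. if b then e else - e) (bernoulli_pmf (1/2))"
  have "(\<integral>w. w \<bullet> v \<partial>measure_pmf ?P) = 0" for v by simp
  moreover have "(\<integral>w. w \<bullet> w \<partial>measure_pmf ?P) \<le> 1"
    using assms by (simp add: dot_square_norm power_le_one)
  moreover have "finite (set_pmf ?P)" by simp
  then have "integrable (measure_pmf ?P) (\<lambda>w. w \<bullet> w)"
    by (rule integrable_measure_pmf_finite)
  ultimately show "(measure_pmf ?P, \<lambda>w. w) \<in> noises"
    by (auto simp: noises_def measure_pmf.prob_space_axioms)
  show "(\<integral>w. (a - v \<bullet> w)\<^sup>2 \<partial>measure_pmf ?P) = a\<^sup>2 + (v \<bullet> e)\<^sup>2" for a v
    by (simp add: power2_eq_square field_simps)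
qed

text \<open>The zero mean removes the linear term, and Cauchy-Schwarz bounds the quadratic one by
  \<open>(norm v)\<^sup>2\<close> times the second moment.\<close>

lemma noise_mean_square_le:
  fixes M :: "'y::real_inner measure"
  assumes "(M, \<eta>) \<in> noises"
  shows "(\<integral>w. (a - v \<bullet> \<eta> w)\<^sup>2 \<partial>M) \<le> a\<^sup>2 + (norm v)\<^sup>2"
proof -
  interpret prob_space M using assms by (simp add: noises_def)
  have meas[measurable]: "\<eta> \<in> borel_measurable M" and mean: "(\<integral>w. \<eta> w \<bullet> v \<partial>M) = 0"
    and int: "integrable M (\<lambda>w. \<eta> w \<bullet> \<eta> w)" and var: "(\<integral>w. \<eta> w \<bullet> \<eta> w \<partial>M) \<le> 1"
    using assms by (auto simp: noises_def)
  have "(\<lambda>x. v \<bullet> x) \<in> borel_measurable borel"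
    by (intro borel_measurable_continuous_onI continuous_intros)
  then have m: "(\<lambda>w. v \<bullet> \<eta> w) \<in> borel_measurable M"
    using measurable_compose[OF meas] by blast
  have cs: "(v \<bullet> \<eta> w)\<^sup>2 \<le> (norm v)\<^sup>2 * (\<eta> w \<bullet> \<eta> w)" for w
    using Cauchy_Schwarz_ineq[of v "\<eta> w"] by (simp add: dot_square_norm)
  have i2: "integrable M (\<lambda>w. (v \<bullet> \<eta> w)\<^sup>2)"
    by (rule Bochner_Integration.integrable_bound[OF integrable_mult_right[OF int, of "(norm v)\<^sup>2"]])
      (use m cs in auto)
  have i1: "integrable M (\<lambda>w. v \<bullet> \<eta> w)"
    by (rule square_integrable_imp_integrable[OF m i2])
  have "(\<integral>w. (a - v \<bullet> \<eta> w)\<^sup>2 \<partial>M) = (\<integral>w. a\<^sup>2 - 2 * a * (v \<bullet> \<eta> w) + (v \<bullet> \<eta> w)\<^sup>2 \<partial>M)"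
    by (simp add: power2_diff algebra_simps)
  also have "\<dots> = a\<^sup>2 - 2 * a * (\<integral>w. v \<bullet> \<eta> w \<partial>M) + (\<integral>w. (v \<bullet> \<eta> w)\<^sup>2 \<partial>M)"
    using i1 i2 by (simp add: prob_space)
  also have "\<dots> = a\<^sup>2 + (\<integral>w. (v \<bullet> \<eta> w)\<^sup>2 \<partial>M)" using mean by (simp add: inner_commute)
  also have "(\<integral>w. (v \<bullet> \<eta> w)\<^sup>2 \<partial>M) \<le> (\<integral>w. (norm v)\<^sup>2 * (\<eta> w \<bullet> \<eta> w) \<partial>M)"
    using i2 int cs by (intro integral_mono) auto
  also have "\<dots> \<le> (norm v)\<^sup>2" using var mult_left_mono[OF var, of "(norm v)\<^sup>2"] by simp
  finally show ?thesis by simp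
qed

section \<open>The a priori minimax value and the a posteriori ellipsoid\<close>

context observed_operator
begin

lemma mean_square_minimax_eq:
  assumes p: "p \<in> D" and rep: "\<forall>x\<in>D. l \<bullet> x = L p \<bullet> L x + H p \<bullet> H x"
  shows "mean_square_minimax D L H l = ereal ((norm (L p, H p))\<^sup>2)"
proof (rule antisym)
  let ?V = "\<lambda>u c \<phi> M \<eta>. \<integral>w. (l \<bullet> \<phi> - u \<bullet> (H \<phi> + \<eta> w) - c)\<^sup>2 \<partial>M"
  have V: "?V u c \<phi> M \<eta> = (\<integral>w. ((l \<bullet> \<phi> - u \<bullet> H \<phi> - c) - u \<bullet> \<eta> w)\<^sup>2 \<partial>M)" for u c \<phi> \<eta> and M :: "'y measure"
    by (simp add: inner_add_right algebra_simps)
  have N: "(norm (L p, H p))\<^sup>2 = (norm (L p))\<^sup>2 + (norm (H p))\<^sup>2" by (simp add: norm_Pair)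
  show "mean_square_minimax D L H l \<le> ereal ((norm (L p, H p))\<^sup>2)"
    unfolding mean_square_minimax_def
  proof (rule INF_lower2[of "(H p, 0)"], simp, clarsimp intro!: SUP_least)
    fix \<phi> \<eta> and M :: "'y measure"
    assume \<phi>: "\<phi> \<in> D" "norm (L \<phi>) \<le> 1" and noise: "(M, \<eta>) \<in> noises"
    have "\<bar>L p \<bullet> L \<phi>\<bar> \<le> norm (L p) * norm (L \<phi>)" by (rule Cauchy_Schwarz_ineq2)
    also have "\<dots> \<le> norm (L p)" using \<phi> by (simp add: mult_left_le)
    finally have "(L p \<bullet> L \<phi>)\<^sup>2 \<le> (norm (L p))\<^sup>2" by (simp add: abs_le_square_iff[symmetric])
    then show "(\<integral>w. (l \<bullet> \<phi> - H p \<bullet> (H \<phi> + \<eta> w))\<^sup>2 \<partial>M) \<le> (norm (L p, H p))\<^sup>2"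
      using noise_mean_square_le[OF noise, of "L p \<bullet> L \<phi>" "H p"] bspec[OF rep \<phi>(1)]
      by (simp add: N inner_add_right)
  qed
  show "ereal ((norm (L p, H p))\<^sup>2) \<le> mean_square_minimax D L H l"
    unfolding mean_square_minimax_def
  proof (rule INF_greatest, clarify)
    fix u :: 'y and c :: real
    \<comment> \<open>Noise along \<open>u\<close> contributes the full
      \<open>(norm u)\<^sup>2\<close>. Using \<open>sgn u\<close> includes \<open>u = 0\<close>,
      where the noise degenerates to 0.\<close>
    obtain M :: "'y measure" and \<eta> where noise: "(M, \<eta>) \<in> noises"
      and var: "\<And>a v. (\<integral>w. (a - v \<bullet> \<eta> w)\<^sup>2 \<partial>M) = a\<^sup>2 + (v \<bullet> sgn u)\<^sup>2"
      using two_point_noise[of "sgn u"] by (metis norm_sgn order_refl zero_le_one)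
    have "u \<bullet> sgn u = norm u" 
      by (cases "u = 0") (simp_all add: sgn_div_norm dot_square_norm power2_eq_square)
    then have V': "?V u c \<phi> M \<eta> = (l \<bullet> \<phi> - u \<bullet> H \<phi> - c)\<^sup>2 + (norm u)\<^sup>2" for \<phi>
      unfolding V var by simp
    \<comment> \<open>The departure from the choice \<open>u = H p\<close>: it alters the bias along
      \<open>p\<close> through \<open>d \<bullet> H p\<close>, and \<open>(norm u)\<^sup>2\<close>
      through the same quantity.\<close>
    define d where "d = u - H p"
    have val: "l \<bullet> (t *\<^sub>R p) - u \<bullet> H (t *\<^sub>R p) = t * ((norm (L p))\<^sup>2 - d \<bullet> H p)" for t
      using bspec[OF rep p] bspec[OF rep D_scale[OF p], of t]
      by (simp add: H.scaleR L_scale[OF p] d_def inner_diff_left power2_norm_eq_inner algebra_simps)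
    have u: "(norm u)\<^sup>2 = (norm (H p))\<^sup>2 + 2 * (d \<bullet> H p) + (norm d)\<^sup>2"
      by (simp add: d_def power2_norm_eq_inner inner_diff_left inner_diff_right inner_commute)
    have "\<exists>t. norm (L (t *\<^sub>R p)) \<le> 1 \<and> (norm (L p, H p))\<^sup>2 \<le> ?V u c (t *\<^sub>R p) M \<eta>"
    proof (cases "L p = 0")
      \<comment> \<open>The constraint \<open>norm (L \<phi>) \<le> 1\<close> does not restrict multiples of \<open>p\<close> here.\<close>
      case True
      \<comment> \<open>If \<open>d\<close> is orthogonal to \<open>H p\<close>, the noise term
        already suffices by \<open>u\<close>. Otherwise the bias ranges over all reals as
        \<open>t\<close> varies, and \<open>t\<close> is tuned to make its square
        \<open>(norm (H p))\<^sup>2\<close>.\<close>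
      have "\<exists>t. (norm (H p))\<^sup>2 \<le> (t * (d \<bullet> H p) + c)\<^sup>2 + (norm u)\<^sup>2"
      proof (cases "d \<bullet> H p = 0")
        case True
        then show ?thesis by (simp add: u)
      next
        case False
        then have "((norm (H p) - c) / (d \<bullet> H p) * (d \<bullet> H p) + c)\<^sup>2 = (norm (H p))\<^sup>2" by simp
        then show ?thesis by (metis le_add_same_cancel1 zero_le_power2)
      qed
      then obtain t where "(norm (H p))\<^sup>2 \<le> (t * (d \<bullet> H p) + c)\<^sup>2 + (norm u)\<^sup>2" by blast
      moreover have "(- (t * (d \<bullet> H p)) - c)\<^sup>2 = (t * (d \<bullet> H p) + c)\<^sup>2"
        by (simp add: power2_eq_square algebra_simps)
      ultimately have "(norm (L p, H p))\<^sup>2 \<le> ?V u c (t *\<^sub>R p) M \<eta>"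
        unfolding V' val N using True by simp
      then show ?thesis using True by (intro exI[of _ t]) (simp add: L_scale[OF p])
    next
      case False
      define a where "a = norm (L p)"
      \<comment> \<open>\<open>s\<close> is the bias before subtracting \<open>c\<close> at
        \<open>t = 1 / a\<close>, where the constraint is tight; \<open>t = - 1 / a\<close> gives
        \<open>- s\<close>. The two squared biases average to \<open>s\<^sup>2 + c\<^sup>2\<close>,
        so for one sign the constant \<open>c\<close> brings no gain.\<close>
      define s where "s = (a\<^sup>2 - d \<bullet> H p) / a"
      have a: "a > 0" using False by (simp add: a_def)
      have "s\<^sup>2 \<le> (s - c)\<^sup>2 \<or> s\<^sup>2 \<le> (- s - c)\<^sup>2"
      proof -
        have "(s - c)\<^sup>2 + (- s - c)\<^sup>2 = 2 * s\<^sup>2 + 2 * c\<^sup>2"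
          by (simp add: power2_eq_square algebra_simps)
        then show ?thesis using zero_le_power2[of c] by linarith
      qed
      then obtain t where t: "t = 1 / a \<or> t = - 1 / a" and "s\<^sup>2 \<le> (t * (a\<^sup>2 - d \<bullet> H p) - c)\<^sup>2"
        unfolding s_def by force
      moreover have "norm (L (t *\<^sub>R p)) \<le> 1" using t a by (auto simp: L_scale[OF p] a_def)
      moreover have "a\<^sup>2 + (norm (H p))\<^sup>2 \<le> s\<^sup>2 + (norm u)\<^sup>2"
      proof -
        \<comment> \<open>The term \<open>- 2 * (d \<bullet> H p)\<close> cancels against the one in
          \<open>(norm u)\<^sup>2\<close>, and what is left over is a sum of squares.\<close>
        have "s\<^sup>2 = a\<^sup>2 - 2 * (d \<bullet> H p) + (d \<bullet> H p / a)\<^sup>2"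
          using a by (simp add: s_def power2_eq_square field_simps)
        then show ?thesis using u by simp
      qed
      ultimately show ?thesis
        unfolding V' val N a_def[symmetric] by (intro exI[of _ t]) linarith
    qed
    then obtain t where "norm (L (t *\<^sub>R p)) \<le> 1" "(norm (L p, H p))\<^sup>2 \<le> ?V u c (t *\<^sub>R p) M \<eta>" by blast
    then show "ereal ((norm (L p, H p))\<^sup>2) \<le>
        (SUP (\<phi>, M, \<eta>)\<in>{\<phi> \<in> D. norm (L \<phi>) \<le> 1} \<times> noises. ereal (?V u c \<phi> M \<eta>))"
      using noise D_scale[OF p] by (intro SUP_upper2[of "(t *\<^sub>R p, M, \<eta>)"]) auto
  qed
qed

lemma apriori_error_eq:
  assumes "p \<in> D" "\<forall>x\<in>D. l \<bullet> x = L p \<bullet> L x + H p \<bullet> H x"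
  shows "apriori_error D L H l = ereal (norm (L p, H p))"
  using mean_square_minimax_eq[OF assms] by (simp add: apriori_error_def)

text \<open>Cauchy-Schwarz in the product space, with equality at the multiple of \<open>p\<close>
  lying on the boundary of the ellipsoid.\<close>

lemma SUP_over_ellipsoid_eq:
  assumes p: "p \<in> D" and rep: "\<forall>x\<in>D. l \<bullet> x = L p \<bullet> L x + H p \<bullet> H x" and r: "0 \<le> r"
  shows "(SUP z\<in>{z\<in>D. (norm (L z, H z))\<^sup>2 \<le> r}. ereal \<bar>l \<bullet> z\<bar>)
    = ereal (sqrt r * norm (L p, H p))"
proof (rule antisym)
  show "(SUP z\<in>{z\<in>D. (norm (L z, H z))\<^sup>2 \<le> r}. ereal \<bar>l \<bullet> z\<bar>) \<le> ereal (sqrt r * norm (L p, H p))"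
  proof (rule SUP_least, clarify)
    fix z assume z: "z \<in> D" "(norm (L z, H z))\<^sup>2 \<le> r"
    then have "norm (L z, H z) \<le> sqrt r" by (simp add: real_le_rsqrt)
    moreover have "\<bar>(L p, H p) \<bullet> (L z, H z)\<bar> \<le> norm (L p, H p) * norm (L z, H z)"
      by (rule Cauchy_Schwarz_ineq2)
    ultimately show "ereal \<bar>l \<bullet> z\<bar> \<le> ereal (sqrt r * norm (L p, H p))"
      using bspec[OF rep z(1)] mult_left_mono[of "norm (L z, H z)" "sqrt r" "norm (L p, H p)"]
      by (simp add: mult.commute)
  qed
  \<comment> \<open>If \<open>(L p, H p) = 0\<close>, division by zero yields \<open>t = 0\<close>,
    and the claimed value is 0 as well.\<close>
  define t where "t = sqrt r / norm (L p, H p)"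
  have Lt: "(L (t *\<^sub>R p), H (t *\<^sub>R p)) = t *\<^sub>R (L p, H p)"
    by (simp add: L_scale[OF p] H.scaleR)
  have "norm (t *\<^sub>R (L p, H p)) \<le> sqrt r"
    unfolding norm_scaleR using r by (cases "(L p, H p) = 0") (simp_all add: t_def)
  then have "(norm (t *\<^sub>R (L p, H p)))\<^sup>2 \<le> (sqrt r)\<^sup>2" by (intro power_mono) auto
  moreover have "l \<bullet> (t *\<^sub>R p) = sqrt r * norm (L p, H p)"
  proof -
    have "l \<bullet> p = (norm (L p, H p))\<^sup>2"
      unfolding bspec[OF rep p] power2_norm_eq_inner by simp
    then show ?thesis
      by (cases "(L p, H p) = 0") (simp_all add: t_def power2_eq_square)
  qed
  ultimately show "ereal (sqrt r * norm (L p, H p)) \<le> (SUP z\<in>{z\<in>D. (norm (L z, H z))\<^sup>2 \<le> r}. ereal \<bar>l \<bullet> z\<bar>)"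
    using r D_scale[OF p, of t] by (intro SUP_upper2[of "t *\<^sub>R p"]) (auto simp: Lt)
qed

text \<open>The ellipsoid contains the whole line through a common kernel vector \<open>x\<close>,
  on which a linear functional is bounded only if it vanishes.\<close>

lemma vanishes_on_kernel_if_SUP_finite:
  assumes fin: "(SUP z\<in>{z\<in>D. (norm (L z, H z))\<^sup>2 \<le> r}. ereal \<bar>l \<bullet> z\<bar>) \<noteq> \<infinity>" and r: "0 \<le> r"
    and x: "x \<in> D" "L x = 0" "H x = 0"
  shows "l \<bullet> x = 0"
proof (rule ccontr)
  assume "l \<bullet> x \<noteq> 0"
  have up: "ereal \<bar>t * (l \<bullet> x)\<bar> \<le> (SUP z\<in>{z\<in>D. (norm (L z, H z))\<^sup>2 \<le> r}. ereal \<bar>l \<bullet> z\<bar>)" for t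
    using x r D_scale[OF x(1), of t]
    by (intro SUP_upper2[of "t *\<^sub>R x"]) (auto simp: L_scale H.scaleR norm_Pair)
  obtain B where "(SUP z\<in>{z\<in>D. (norm (L z, H z))\<^sup>2 \<le> r}. ereal \<bar>l \<bullet> z\<bar>) \<le> ereal B"
    using fin by (cases "SUP z\<in>{z\<in>D. (norm (L z, H z))\<^sup>2 \<le> r}. ereal \<bar>l \<bullet> z\<bar>") auto
  with up have "\<bar>t * (l \<bullet> x)\<bar> \<le> B" for t by (meson ereal_less_eq(3) order_trans)
  from this[of "(\<bar>B\<bar> + 1) / (l \<bullet> x)"] show False using \<open>l \<bullet> x \<noteq> 0\<close> by simp
qed

end

theorem mainTheorem2:
  fixes D :: "'h::{real_inner, complete_space} set"
    and L :: "'h \<Rightarrow> 'f::{real_inner, complete_space}"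
    and H :: "'h \<Rightarrow> 'y::{real_inner, complete_space}"
    and G :: "('f \<times> 'y) set" and X :: "'h set" and R :: "'h set"
    and y :: 'y and l :: 'h
  assumes L: "closed_dense_operator D L"
    and H: "bounded_linear H"
    and G: "G = {(f, \<eta>). (norm f)\<^sup>2 + (norm \<eta>)\<^sup>2 \<le> 1}"
    and y: "\<exists>\<phi>\<in>D. \<exists>\<eta>. y = H \<phi> + \<eta> \<and> (L \<phi>, \<eta>) \<in> G"
    and ranges: "(closed (L ` D) \<and> closed (H ` {x\<in>D. L x = 0})) \<or>
                 closed ((\<lambda>x. (L x, H x)) ` D)"
    and X: "X = apost_set D L H G y"
    and R: "R = {a + b | a b. a \<in> adj D L ` adj_dom D L \<and> b \<in> range (adjoint H)}"
  shows "((\<exists>\<phi> q. minimax_apost_est X l \<phi> \<and> estimation_equations D L H y \<phi> q) \<longleftrightarrow> l \<in> R) \<and>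
    (\<forall>\<phi> q. estimation_equations D L H y \<phi> q \<longrightarrow> (minimax_apost_est X l \<phi> \<longleftrightarrow> l \<in> R)) \<and>
    (\<forall>\<phi>. minimax_apost_est X l \<phi> \<longrightarrow>
        (\<exists>\<phi>' q'. estimation_equations D L H y \<phi>' q' \<and> l \<bullet> \<phi>' = l \<bullet> \<phi>)) \<and>
    (\<forall>\<phi> q. minimax_apost_est X l \<phi> \<and> estimation_equations D L H y \<phi> q \<longrightarrow>
        apost_error X l = ereal (sqrt (1 - y \<bullet> (y - H \<phi>))) * apriori_error D L H l)"
proof -
  interpret observed_operator D L H using L H by (rule observed_operator.intro)
  interpret closed_range_observed_operator D L H
    by unfold_locales (use ranges closed_joint_range in blast)
  define r where "r \<phi> = 1 - y \<bullet> (y - H \<phi>)" for \<phi>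
  define Z where "Z \<phi> = {z\<in>D. (norm (L z, H z))\<^sup>2 \<le> r \<phi>}" for \<phi>
  have "X \<noteq> {}" using y unfolding X apost_set_def by force
  have centered: "X = (+) \<phi> ` Z \<phi>" if "estimation_equations D L H y \<phi> q" for \<phi> q
    unfolding X Z_def r_def by (rule apost_set_centered[OF that G])
  \<comment> \<open>That \<open>y\<close> is an admissible observation enters here: a nonempty
    ellipsoid forces the radius to be nonnegative, so the square root in the error formula is a
    genuine one.\<close>
  have r: "0 \<le> r \<phi>" if "estimation_equations D L H y \<phi> q" for \<phi> q
  proof -
    have "Z \<phi> \<noteq> {}" using centered[OF that] \<open>X \<noteq> {}\<close> by blast
    then show ?thesis using order_trans[OF zero_le_power2] by (auto simp: Z_def)
  qed
  have Z: "0 \<in> Z \<phi>" "\<forall>z\<in>Z \<phi>. - z \<in> Z \<phi>" if "estimation_equations D L H y \<phi> q" for \<phi> q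
    using r[OF that] D_scale[of _ "-1"] L_scale[of _ "-1"]
    by (auto simp: Z_def D_zero L_zero H.zero H.neg norm_Pair)
  have err: "apost_error X l = (SUP z\<in>Z \<phi>. ereal \<bar>l \<bullet> z\<bar>)"
    and est: "minimax_apost_est X l \<psi> \<longleftrightarrow> (SUP z\<in>Z \<phi>. ereal \<bar>l \<bullet> z\<bar>) \<noteq> \<infinity> \<and> l \<bullet> \<psi> = l \<bullet> \<phi>"
    if "estimation_equations D L H y \<phi> q" for \<phi> q \<psi>
    unfolding centered[OF that]
    using apost_error_symmetric[OF Z[OF that]] minimax_apost_est_symmetric[OF Z[OF that]] by blast+
  have finite_iff: "(SUP z\<in>Z \<phi>. ereal \<bar>l \<bullet> z\<bar>) \<noteq> \<infinity> \<longleftrightarrow> l \<in> R"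
    if "estimation_equations D L H y \<phi> q" for \<phi> q
  proof
    assume "(SUP z\<in>Z \<phi>. ereal \<bar>l \<bullet> z\<bar>) \<noteq> \<infinity>"
    then show "l \<in> R"
      unfolding R in_sum_of_adjoint_ranges_iff Z_def
      by (intro representation vanishes_on_kernel_if_SUP_finite[OF _ r[OF that]])
  next
    assume "l \<in> R"
    then obtain p where "p \<in> D" "\<forall>x\<in>D. l \<bullet> x = L p \<bullet> L x + H p \<bullet> H x"
      unfolding R in_sum_of_adjoint_ranges_iff by blast
    then show "(SUP z\<in>Z \<phi>. ereal \<bar>l \<bullet> z\<bar>) \<noteq> \<infinity>"
      unfolding Z_def using SUP_over_ellipsoid_eq[OF _ _ r[OF that]] by simp
  qed
  have error: "apost_error X l = ereal (sqrt (r \<phi>)) * apriori_error D L H l"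
    if eqs: "estimation_equations D L H y \<phi> q" and "l \<in> R" for \<phi> q
  proof -
    obtain p where p: "p \<in> D" "\<forall>x\<in>D. l \<bullet> x = L p \<bullet> L x + H p \<bullet> H x"
      using \<open>l \<in> R\<close> unfolding R in_sum_of_adjoint_ranges_iff by blast
    show ?thesis
      unfolding err[OF eqs] Z_def SUP_over_ellipsoid_eq[OF p r[OF eqs]] apriori_error_eq[OF p]
      by simp
  qed
  \<comment> \<open>One solution suffices for the existence claims: by \<open>est\<close>, it is an
    estimation as soon as any exists, and every estimation shares its component along
    \<open>l\<close>.\<close>
  obtain \<phi>0 q0 where eqs0: "estimation_equations D L H y \<phi>0 q0"
    using estimation_equations_solvable by blast
  have est_R: "minimax_apost_est X l \<phi> \<longleftrightarrow> l \<in> R" if "estimation_equations D L H y \<phi> q" for \<phi> q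
    using est[OF that] finite_iff[OF that] by simp
  show ?thesis
    using eqs0 est_R est error unfolding r_def by metis
qed

end
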